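(* For every $t\in\mathbb{N}$ and every $\beta=(\beta_3,\beta_4,\dots,\beta_t)\in\mathbb{C}^{t-2}$, the second cohomology group $H^2(R(\mathfrak{m}_0,2,\beta),R(\mathfrak{m}_0,2,\beta))$ of the Lie algebra $R(\mathfrak{m}_0,2,\beta)$ is trivial (i.e. zero).
   Context: $R(\mathfrak{m}_0,2,\beta)$ is the Lie algebra over $\mathbb{C}$ with basis $\{x,y,e_1,e_2,\dots\}$ (elements are finite linear combinations of basis elements) and products $$[e_i,e_1]=e_{i+1}\ (i\ge 2),\quad [e_1,x]=e_1,\quad [e_i,x]=(i-1)e_i+\sum_{q=3}^{t}\beta_q e_{q+i-2}\ (i\ge 2),\quad [e_i,y]=e_i\ (i\ge 2),$$ where products of basis elements that are neither listed nor obtained from listed ones by antisymmetry are zero, and empty sums are zero. For a Lie algebra $L$, $H^2(L,L)=Z^2(L,L)/B^2(L,L)$, where $Z^2(L,L)$ is the set of $\varphi\in\mathrm{Hom}(\wedge^2L,L)$ with $$[a,\varphi(b,c)]-[\varphi(a,b),c]+[\varphi(a,c),b]+\varphi(a,[b,c])-\varphi([a,b],c)+\varphi([a,c],b)=0\quad\text{for all }a,b,c\in L,$$ and $B^2(L,L)$ is the set of $\psi\in\mathrm{Hom}(\wedge^2L,L)$ for which there exists $f\in\mathrm{Hom}(L,L)$ with $\psi(a,b)=f([a,b])-[f(a),b]-[a,f(b)]$ for all $a,b\in L$. Here $\mathrm{Hom}$ denotes all linear maps. *)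

theory Defs
  imports Complex_Main "HOL-Library.Poly_Mapping" "HOL-Algebra.Elementary_Groups"
begin

section \<open>Adjoint cohomology in degree two\<close>

locale lie_algebra = vector_space scale
  for scale :: "'k::field \<Rightarrow> 'v::ab_group_add \<Rightarrow> 'v" +
  fixes br :: "'v \<Rightarrow> 'v \<Rightarrow> 'v"
  assumes br_add_left: "br (a + b) c = br a c + br b c"
    and br_add_right: "br a (b + c) = br a b + br a c"
    and br_scale_left: "br (scale r a) b = scale r (br a b)"
    and br_scale_right: "br a (scale r b) = scale r (br a b)"
    and br_self: "br a a = 0"
    and jacobi: "br a (br b c) + br b (br c a) + br c (br a b) = 0"

text \<open>\<open>Hom(L, L)\<close> and \<open>Hom(\<Lambda>\<^sup>2 L, L)\<close>, the latter as alternating bilinear maps.\<close>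

definition Hom1 :: "('k::field \<Rightarrow> 'v::ab_group_add \<Rightarrow> 'v) \<Rightarrow> ('v \<Rightarrow> 'v) set"
  where "Hom1 scale = {f. Vector_Spaces.linear scale scale f}"

definition Hom2 :: "('k::field \<Rightarrow> 'v::ab_group_add \<Rightarrow> 'v) \<Rightarrow> ('v \<Rightarrow> 'v \<Rightarrow> 'v) set"
  where "Hom2 scale = {\<phi>.
    (\<forall>b. Vector_Spaces.linear scale scale (\<lambda>a. \<phi> a b)) \<and>
    (\<forall>a. Vector_Spaces.linear scale scale (\<phi> a)) \<and>
    (\<forall>a. \<phi> a a = 0)}"

definition Z2 :: "('k::field \<Rightarrow> 'v::ab_group_add \<Rightarrow> 'v) \<Rightarrow> ('v \<Rightarrow> 'v \<Rightarrow> 'v) \<Rightarrow> ('v \<Rightarrow> 'v \<Rightarrow> 'v) set"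
  where "Z2 scale br = {\<phi> \<in> Hom2 scale. \<forall>a b c.
    br a (\<phi> b c) - br (\<phi> a b) c + br (\<phi> a c) b
      + \<phi> a (br b c) - \<phi> (br a b) c + \<phi> (br a c) b = 0}"

definition B2 :: "('k::field \<Rightarrow> 'v::ab_group_add \<Rightarrow> 'v) \<Rightarrow> ('v \<Rightarrow> 'v \<Rightarrow> 'v) \<Rightarrow> ('v \<Rightarrow> 'v \<Rightarrow> 'v) set"
  where "B2 scale br = {\<psi> \<in> Hom2 scale. \<exists>f \<in> Hom1 scale. \<forall>a b.
    \<psi> a b = f (br a b) - br (f a) b - br a (f b)}"

definition Z2_group ::
    "('k::field \<Rightarrow> 'v::ab_group_add \<Rightarrow> 'v) \<Rightarrow> ('v \<Rightarrow> 'v \<Rightarrow> 'v) \<Rightarrow> ('v \<Rightarrow> 'v \<Rightarrow> 'v) monoid"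
  where "Z2_group scale br =
    \<lparr>carrier = Z2 scale br, mult = (\<lambda>\<phi> \<psi> a b. \<phi> a b + \<psi> a b), one = (\<lambda>a b. 0)\<rparr>"

text \<open>The quotient \<open>Z\<^sup>2/B\<^sup>2\<close> as an additive group; its scalar multiplication
  plays no role for the question whether it is zero.\<close>

definition H2 ::
    "('k::field \<Rightarrow> 'v::ab_group_add \<Rightarrow> 'v) \<Rightarrow> ('v \<Rightarrow> 'v \<Rightarrow> 'v) \<Rightarrow> ('v \<Rightarrow> 'v \<Rightarrow> 'v) set monoid"
  where "H2 scale br = Z2_group scale br Mod B2 scale br"


section \<open>The Lie algebra \<open>R(m\<^sub>0, 2, \<beta>)\<close>\<close>

text \<open>The basis \<open>x, y, e\<^sub>1, e\<^sub>2, \<dots>\<close>. To make the index range start at 1, the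
  constructor is shifted: \<open>BE m\<close> is \<open>e\<close> with index \<open>m + 1\<close>.\<close>

datatype basis = BX | BY | BE nat

type_synonym R = "basis \<Rightarrow>\<^sub>0 complex"

definition R_scale :: "complex \<Rightarrow> R \<Rightarrow> R"
  where "R_scale c u = Poly_Mapping.map (\<lambda>z. c * z) u"

definition R_x :: R where "R_x = Poly_Mapping.single BX 1"
definition R_y :: R where "R_y = Poly_Mapping.single BY 1"

text \<open>Only meaningful for \<open>i \<ge> 1\<close>.\<close>

definition R_e :: "nat \<Rightarrow> R" where "R_e i = Poly_Mapping.single (BE (i - 1)) 1"

text \<open>The products in the listed order of arguments, and zero otherwise; the bracket
  arises by antisymmetrizing (no product is listed in both orders) and extending
  bilinearly. The values of \<open>\<beta>\<close> outside \<open>{3..t}\<close> are irrelevant.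
  The lemmas \<open>bracket_*\<close> below restate the table in terms of \<open>R_x\<close>, \<open>R_y\<close>, \<open>R_e i\<close>.\<close>

fun listed :: "nat \<Rightarrow> (nat \<Rightarrow> complex) \<Rightarrow> basis \<Rightarrow> basis \<Rightarrow> R" where
  "listed t \<beta> (BE m) (BE n) = (if m \<ge> 1 \<and> n = 0 then R_e (m + 2) else 0)"
| "listed t \<beta> (BE m) BX =
    (if m = 0 then R_e 1
     else R_scale (of_nat m) (R_e (m + 1)) + (\<Sum>q=3..t. R_scale (\<beta> q) (R_e (q + (m + 1) - 2))))"
| "listed t \<beta> (BE m) BY = (if m = 0 then 0 else R_e (m + 1))"
| "listed t \<beta> _ _ = 0"

definition R_bracket :: "nat \<Rightarrow> (nat \<Rightarrow> complex) \<Rightarrow> R \<Rightarrow> R \<Rightarrow> R"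
  where "R_bracket t \<beta> u v =
    (\<Sum>a\<in>Poly_Mapping.keys u. \<Sum>b\<in>Poly_Mapping.keys v.
      R_scale (Poly_Mapping.lookup u a * Poly_Mapping.lookup v b)
        (listed t \<beta> a b - listed t \<beta> b a))"

lemma lookup_R_scale [simp]:
  "Poly_Mapping.lookup (R_scale c u) k = c * Poly_Mapping.lookup u k"
  unfolding R_scale_def by (simp add: Poly_Mapping.map.rep_eq when_def)

lemma vector_space_R: "vector_space R_scale"
  by unfold_locales (auto intro!: poly_mapping_eqI simp: lookup_add algebra_simps)

interpretation R: vector_space R_scale
  by (rule vector_space_R)

lemma R_bracket_superset:
  assumes "finite A" "finite B" "Poly_Mapping.keys u \<subseteq> A" "Poly_Mapping.keys v \<subseteq> B"
  shows "R_bracket t \<beta> u v =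
    (\<Sum>a\<in>A. \<Sum>b\<in>B. R_scale (Poly_Mapping.lookup u a * Poly_Mapping.lookup v b)
        (listed t \<beta> a b - listed t \<beta> b a))"
proof -
  have 1: "(\<Sum>b\<in>Poly_Mapping.keys v. R_scale (Poly_Mapping.lookup u a * Poly_Mapping.lookup v b)
        (listed t \<beta> a b - listed t \<beta> b a)) = (\<Sum>b\<in>B. R_scale (Poly_Mapping.lookup u a * Poly_Mapping.lookup v b)
        (listed t \<beta> a b - listed t \<beta> b a))" for a
    using assms by (intro sum.mono_neutral_left) (auto simp: in_keys_iff)
  show ?thesis
    unfolding R_bracket_def 1
    using assms by (intro sum.mono_neutral_left) (auto simp: in_keys_iff)
qed

lemma R_bracket_add_left: "R_bracket t \<beta> (u + u') v = R_bracket t \<beta> u v + R_bracket t \<beta> u' v"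
proof -
  let ?A = "Poly_Mapping.keys u \<union> Poly_Mapping.keys u'"
  have *: "Poly_Mapping.keys (u + u') \<subseteq> ?A" by (rule Poly_Mapping.keys_add)
  show ?thesis
    by (subst (1 2 3) R_bracket_superset[where A = ?A and B = "Poly_Mapping.keys v"])
      (auto simp: * lookup_add R.scale_left_distrib distrib_right sum.distrib dest: subsetD[OF *])
qed

lemma R_bracket_antisym: "R_bracket t \<beta> u v = - R_bracket t \<beta> v u"
  unfolding R_bracket_def
  by (subst sum.swap)
    (simp add: sum_negf[symmetric] R.scale_minus_right[symmetric] mult.commute del: sum_negf)

lemma R_bracket_add_right: "R_bracket t \<beta> u (v + v') = R_bracket t \<beta> u v + R_bracket t \<beta> u v'"
  by (simp add: R_bracket_antisym[of t \<beta> u] R_bracket_add_left)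

lemma R_bracket_scale_left: "R_bracket t \<beta> (R_scale c u) v = R_scale c (R_bracket t \<beta> u v)"
proof -
  have *: "Poly_Mapping.keys (R_scale c u) \<subseteq> Poly_Mapping.keys u" by (auto simp: in_keys_iff)
  show ?thesis
    by (subst (1 2) R_bracket_superset[where A = "Poly_Mapping.keys u" and B = "Poly_Mapping.keys v"])
      (auto simp: R.scale_sum_right mult.assoc dest: subsetD[OF *])
qed

lemma R_bracket_scale_right: "R_bracket t \<beta> u (R_scale c v) = R_scale c (R_bracket t \<beta> u v)"
  by (simp add: R_bracket_antisym[of t \<beta> u] R_bracket_scale_left)

lemma R_bracket_self: "R_bracket t \<beta> u u = 0"
proof (rule poly_mapping_eqI)
  fix k
  have "Poly_Mapping.lookup (R_bracket t \<beta> u u) k = - Poly_Mapping.lookup (R_bracket t \<beta> u u) k"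
    by (metis R_bracket_antisym lookup_uminus)
  then show "Poly_Mapping.lookup (R_bracket t \<beta> u u) k = Poly_Mapping.lookup 0 k" by simp
qed

lemma R_bracket_zero [simp]: "R_bracket t \<beta> 0 v = 0" "R_bracket t \<beta> u 0 = 0"
  by (simp_all add: R_bracket_def)

lemma R_bracket_sum_left: "R_bracket t \<beta> (\<Sum>i\<in>I. g i) v = (\<Sum>i\<in>I. R_bracket t \<beta> (g i) v)"
  by (induction I rule: infinite_finite_induct) (simp_all add: R_bracket_add_left)

lemma R_bracket_sum_right: "R_bracket t \<beta> u (\<Sum>i\<in>I. g i) = (\<Sum>i\<in>I. R_bracket t \<beta> u (g i))"
  by (induction I rule: infinite_finite_induct) (simp_all add: R_bracket_add_right)

lemma R_bracket_single:
  "R_bracket t \<beta> (Poly_Mapping.single a 1) (Poly_Mapping.single b 1) = listed t \<beta> a b - listed t \<beta> b a"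
  by (simp add: R_bracket_def)

lemma bracket_e_e1: "i \<ge> 2 \<Longrightarrow> R_bracket t \<beta> (R_e i) (R_e 1) = R_e (i + 1)"
  by (auto simp: R_e_def R_bracket_single intro: arg_cong)

lemma bracket_e1_x: "R_bracket t \<beta> (R_e 1) R_x = R_e 1"
  by (simp add: R_e_def R_x_def R_bracket_single)

lemma bracket_e_x:
  "i \<ge> 2 \<Longrightarrow> R_bracket t \<beta> (R_e i) R_x
    = R_scale (of_nat (i - 1)) (R_e i) + (\<Sum>q=3..t. R_scale (\<beta> q) (R_e (q + i - 2)))"
  by (simp add: R_e_def R_x_def R_bracket_single)

lemma bracket_e_y: "i \<ge> 2 \<Longrightarrow> R_bracket t \<beta> (R_e i) R_y = R_e i"
  by (simp add: R_e_def R_y_def R_bracket_single)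

lemma bracket_e1_y: "R_bracket t \<beta> (R_e 1) R_y = 0"
  by (simp add: R_e_def R_y_def R_bracket_single)

lemma bracket_x_y: "R_bracket t \<beta> R_x R_y = 0"
  by (simp add: R_x_def R_y_def R_bracket_single)

lemma bracket_e_e: "i \<ge> 2 \<Longrightarrow> j \<ge> 2 \<Longrightarrow> R_bracket t \<beta> (R_e i) (R_e j) = 0"
  by (simp add: R_e_def R_bracket_single)

lemma R_expand:
  "u = (\<Sum>a\<in>Poly_Mapping.keys u. R_scale (Poly_Mapping.lookup u a) (Poly_Mapping.single a 1))"
  by (rule poly_mapping_eqI)
    (auto simp: lookup_sum lookup_single when_def in_keys_iff if_distrib[where f = "(*) _"] cong: if_cong)

lemma single_cases:
  obtains "Poly_Mapping.single a (1::complex) = R_x" | "Poly_Mapping.single a (1::complex) = R_y"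
  | "Poly_Mapping.single a (1::complex) = R_e 1"
  | k where "Poly_Mapping.single a (1::complex) = R_e (k + 2)"
proof (cases a)
  case (BE m)
  then show ?thesis
    using that(3,4) by (cases m) (auto simp: R_e_def)
qed (use that in \<open>auto simp: R_x_def R_y_def\<close>)

definition jacobiator :: "nat \<Rightarrow> (nat \<Rightarrow> complex) \<Rightarrow> R \<Rightarrow> R \<Rightarrow> R \<Rightarrow> R"
  where "jacobiator t \<beta> u v w = R_bracket t \<beta> u (R_bracket t \<beta> v w)
    + R_bracket t \<beta> v (R_bracket t \<beta> w u) + R_bracket t \<beta> w (R_bracket t \<beta> u v)"

lemma jacobiator_cycle: "jacobiator t \<beta> u v w = jacobiator t \<beta> v w u"
  by (simp add: jacobiator_def add_ac)

lemma jacobiator_basis: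
  "jacobiator t \<beta> (Poly_Mapping.single a 1) (Poly_Mapping.single b 1) (Poly_Mapping.single c 1) = 0"
proof -
  note tab = bracket_e_e1 bracket_e1_x bracket_e_y bracket_e1_y bracket_x_y bracket_e_e R_bracket_self
  have ex: "R_bracket t \<beta> (R_e (k + 2)) R_x
      = R_scale (of_nat (k + 1)) (R_e (k + 2)) + (\<Sum>q=3..t. R_scale (\<beta> q) (R_e (q + k)))" for k
    by (simp add: bracket_e_x)
  have n3: "k + 2 + 1 = k + 3" "k + 1 + 2 = k + 3" "k + 1 + 1 = k + 2" "q + (k + 1) = q + k + 1" for k q :: nat
    by simp_all
  have e1: "R_bracket t \<beta> (R_e (k + 2)) (R_e 1) = R_e (k + 3)" for k
    using bracket_e_e1[of "k + 2" t \<beta>] by (simp only: n3 le_add2)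
  have rev: "R_bracket t \<beta> (R_e 1) (R_e (k + 2)) = - R_e (k + 3)"
    "R_bracket t \<beta> R_x (R_e 1) = - R_e 1"
    "R_bracket t \<beta> R_y (R_e (k + 2)) = - R_e (k + 2)"
    "R_bracket t \<beta> R_y (R_e 1) = 0" "R_bracket t \<beta> R_y R_x = 0"
    "R_bracket t \<beta> R_x (R_e (k + 2))
      = - (R_scale (of_nat (k + 1)) (R_e (k + 2)) + (\<Sum>q=3..t. R_scale (\<beta> q) (R_e (q + k))))" for k
    using R_bracket_antisym[of t \<beta> "R_e 1" "R_e (k + 2)"] R_bracket_antisym[of t \<beta> R_x "R_e 1"]
      R_bracket_antisym[of t \<beta> R_y "R_e (k + 2)"] R_bracket_antisym[of t \<beta> R_y "R_e 1"]
      R_bracket_antisym[of t \<beta> R_y R_x] R_bracket_antisym[of t \<beta> R_x "R_e (k + 2)"]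
      bracket_e_y[of "k + 2" t \<beta>]
    by (simp_all only: e1 ex bracket_e1_x bracket_e1_y bracket_x_y minus_zero le_add2)
  have sums: "R_bracket t \<beta> (\<Sum>q=3..t. R_scale (\<beta> q) (R_e (q + k))) (R_e 1)
        = (\<Sum>q=3..t. R_scale (\<beta> q) (R_e (q + k + 1)))"
    "R_bracket t \<beta> (\<Sum>q=3..t. R_scale (\<beta> q) (R_e (q + k))) R_y
        = (\<Sum>q=3..t. R_scale (\<beta> q) (R_e (q + k)))"
    "R_bracket t \<beta> (\<Sum>q=3..t. R_scale (\<beta> q) (R_e (q + k))) (R_e (j + 2)) = 0" for k j
    by (simp_all add: R_bracket_sum_left R_bracket_scale_left tab del: One_nat_def)
  have sums': "R_bracket t \<beta> (R_e 1) (\<Sum>q=3..t. R_scale (\<beta> q) (R_e (q + k)))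
        = - (\<Sum>q=3..t. R_scale (\<beta> q) (R_e (q + k + 1)))"
    "R_bracket t \<beta> R_y (\<Sum>q=3..t. R_scale (\<beta> q) (R_e (q + k)))
        = - (\<Sum>q=3..t. R_scale (\<beta> q) (R_e (q + k)))"
    "R_bracket t \<beta> (R_e (j + 2)) (\<Sum>q=3..t. R_scale (\<beta> q) (R_e (q + k))) = 0" for k j
    by (subst R_bracket_antisym, simp only: sums minus_zero)+
  have minus: "R_bracket t \<beta> (- u) v = - R_bracket t \<beta> u v"
    "R_bracket t \<beta> v (- u) = - R_bracket t \<beta> v u" for u v
    using R_bracket_scale_left[of t \<beta> "- 1" u v] R_bracket_scale_right[of t \<beta> v "- 1" u]
    by simp_all
  have ex3: "R_bracket t \<beta> (R_e (k + 3)) R_x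
      = R_scale (of_nat (k + 2)) (R_e (k + 3)) + (\<Sum>q=3..t. R_scale (\<beta> q) (R_e (q + k + 1)))" for k
    using ex[of "k + 1"] by (simp only: n3)
  have ex3': "R_bracket t \<beta> R_x (R_e (k + 3))
      = - (R_scale (of_nat (k + 2)) (R_e (k + 3)) + (\<Sum>q=3..t. R_scale (\<beta> q) (R_e (q + k + 1))))" for k
    by (subst R_bracket_antisym) (simp only: ex3)
  have e3: "R_bracket t \<beta> (R_e (k + 3)) R_y = R_e (k + 3)" "R_bracket t \<beta> R_y (R_e (k + 3)) = - R_e (k + 3)"
    "R_bracket t \<beta> (R_e (k + 3)) (R_e (j + 2)) = 0" "R_bracket t \<beta> (R_e (j + 2)) (R_e (k + 3)) = 0" for k j
    by (simp_all add: tab R_bracket_antisym[of t \<beta> R_y "R_e (k + 3)"])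
  have two: "R_bracket t \<beta> (R_e (k + 2)) R_y = R_e (k + 2)"
    "R_bracket t \<beta> (R_e (k + 2)) (R_e (j + 2)) = 0" for k j
    by (simp_all add: tab)
  note all = jacobiator_def e1 two e3 ex3 ex3' minus sums sums' rev ex bracket_e1_x bracket_e1_y bracket_x_y
    R_bracket_self R_bracket_zero R_bracket_add_left R_bracket_add_right R_bracket_scale_left R_bracket_scale_right
  have double: "R_scale 2 u = u + u" for u
    by (rule poly_mapping_eqI) (simp add: lookup_add)
  show ?thesis
    by (cases rule: single_cases[of a]; cases rule: single_cases[of b]; cases rule: single_cases[of c];
      simp only: all; simp add: R.scale_left_distrib double del: One_nat_def)
qed

lemma jacobiator_basis_left:
  assumes "\<And>a. jacobiator t \<beta> (Poly_Mapping.single a 1) v w = 0"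
  shows "jacobiator t \<beta> u v w = 0"
proof -
  have scale: "jacobiator t \<beta> (R_scale c u) v w = R_scale c (jacobiator t \<beta> u v w)" for c u
    by (simp add: jacobiator_def R_bracket_scale_left R_bracket_scale_right R.scale_right_distrib)
  have sum: "jacobiator t \<beta> (\<Sum>i\<in>I. g i) v w = (\<Sum>i\<in>I. jacobiator t \<beta> (g i) v w)"
    for I and g :: "basis \<Rightarrow> R"
    by (simp add: jacobiator_def R_bracket_sum_left R_bracket_sum_right sum.distrib)
  show ?thesis
    by (subst R_expand) (simp add: sum scale assms)
qed

lemma jacobiator_zero: "jacobiator t \<beta> u v w = 0"
  by (rule jacobiator_basis_left, subst jacobiator_cycle,
      rule jacobiator_basis_left, subst jacobiator_cycle,
      rule jacobiator_basis_left, rule jacobiator_basis)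

lemma lie_algebra_R: "lie_algebra R_scale (R_bracket t \<beta>)"
  by unfold_locales
    (use jacobiator_zero[of t \<beta>] in \<open>simp_all add: jacobiator_def R_bracket_self R_bracket_add_left
      R_bracket_add_right R_bracket_scale_left R_bracket_scale_right\<close>)

end

theory Submission
  imports Defs
begin

text \<open>
  Write \<open>S = [\<cdot>, e\<^sub>1]\<close> and let \<open>V\<close> be the span of \<open>e\<^sub>2, e\<^sub>3, \<dots>\<close>, an abelian ideal with the complementary
  subalgebra \<open>g = \<langle>x, y, e\<^sub>1\<rangle>\<close>. The map \<open>[\<cdot>, y]\<close> is the projection onto \<open>V\<close> along \<open>g\<close>, so \<open>y\<close> grades
  the algebra by the weights 0 (on \<open>g\<close>) and 1 (on \<open>V\<close>). Moreover \<open>V\<close> is free of rank one over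
  \<open>\<complex>[S]\<close>, generated by \<open>e\<^sub>2\<close>, and on \<open>V\<close> the map \<open>[\<cdot>, x]\<close> is the diagonal map \<open>e\<^sub>i \<mapsto> (i - 1) e\<^sub>i\<close> plus the
  polynomial \<open>\<Sum>q. \<beta>\<^sub>q S\<^bsup>q-2\<^esup>\<close>. Since this polynomial commutes with everything that commutes with \<open>S\<close>,
  the parameters \<open>\<beta>\<close> drop out of every commutator with \<open>[\<cdot>, x]\<close> that matters
  (\<open>commutator_with_X\<close>), and the argument is the same for all \<open>t\<close> and \<open>\<beta>\<close>.

  A given 2-cocycle \<open>\<phi>\<close> is changed by coboundaries until it vanishes.

  \<^item> As \<open>[\<cdot>, y]\<close> is diagonalizable, the part of \<open>\<phi>\<close> of nonzero weight is a coboundary. It suffices to make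
    \<open>\<phi>(\<cdot>, y)\<close> preserve weights; the cocycle identity then makes \<open>\<phi>\<close> preserve them and makes
    \<open>\<phi>(\<cdot>, y)\<close> a derivation (\<open>cocycle_weights\<close>, \<open>exists_weight_preserving_representative\<close>).

  \<^item> A weight-preserving derivation that kills \<open>y\<close> is inner (\<open>derivation_inner\<close>), say \<open>[\<cdot>, z]\<close>, and the
    coboundary of the map \<open>y \<mapsto> -z\<close> removes \<open>\<phi>(\<cdot>, y)\<close>. What remains of \<open>\<phi>\<close> is \<open>\<phi>(x, e\<^sub>1) \<in> g\<close> and the
    two maps \<open>\<phi>(\<cdot>, e\<^sub>1)\<close> and \<open>\<phi>(\<cdot>, x)\<close> from \<open>V\<close> to \<open>V\<close>.

  \<^item> \<open>\<phi>(x, e\<^sub>1)\<close> is removed by changing \<open>x\<close> and \<open>e\<^sub>1\<close>. By freeness of \<open>V\<close>, there is a linear map \<open>F\<close> on \<open>V\<close>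
    with prescribed defect of commuting with \<open>S\<close>, which removes \<open>\<phi>(\<cdot>, e\<^sub>1)\<close> (\<open>B2_if_Y_free\<close>).

  \<^item> Now \<open>\<phi>(\<cdot>, x)\<close> commutes with \<open>S\<close>, so it is determined by \<open>\<phi>(e\<^sub>2, x)\<close>. Subtracting the coboundary of a map that
    commutes with \<open>S\<close> and sends \<open>e\<^sub>2\<close> to \<open>r\<close> changes the coefficient of \<open>e\<^sub>i\<close> in \<open>\<phi>(e\<^sub>2, x)\<close> by \<open>i - 2\<close> times that of
    \<open>r\<close>; this reaches every coefficient except the one at \<open>e\<^sub>2\<close>, which is removed by the coboundary of a
    map that sends \<open>x\<close> to a multiple of \<open>y\<close> (\<open>B2_if_Y_e1_free\<close>). The vector \<open>r\<close> is a finite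
    combination of basis vectors because \<open>\<phi>(e\<^sub>2, x)\<close> is.
\<close>

section \<open>Degree-two cohomology and a diagonalizable element\<close>

definition coboundary :: "('v::ab_group_add \<Rightarrow> 'v \<Rightarrow> 'v) \<Rightarrow> ('v \<Rightarrow> 'v) \<Rightarrow> 'v \<Rightarrow> 'v \<Rightarrow> 'v"
  where "coboundary br f a b = f (br a b) - br (f a) b - br a (f b)"

context lie_algebra
begin

lemma Hom1_iff:
  "f \<in> Hom1 scale \<longleftrightarrow> (\<forall>a b. f (a + b) = f a + f b) \<and> (\<forall>r a. f (scale r a) = scale r (f a))"
  using vector_space_axioms by (auto simp: Hom1_def Vector_Spaces.linear_iff)

lemma Hom2_iff:
  "\<phi> \<in> Hom2 scale \<longleftrightarrow>
    (\<forall>a b c. \<phi> (a + b) c = \<phi> a c + \<phi> b c) \<and> (\<forall>a b c. \<phi> a (b + c) = \<phi> a b + \<phi> a c) \<and>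
    (\<forall>r a b. \<phi> (scale r a) b = scale r (\<phi> a b)) \<and> (\<forall>r a b. \<phi> a (scale r b) = scale r (\<phi> a b)) \<and>
    (\<forall>a. \<phi> a a = 0)"
  using vector_space_axioms by (auto simp: Hom2_def Vector_Spaces.linear_iff)

lemma alternating_antisym:
  assumes "\<phi> \<in> Hom2 scale"
  shows "\<phi> a b = - \<phi> b a"
proof -
  have alt: "\<phi> c c = 0" for c
    using assms by (simp add: Hom2_iff)
  have add: "\<phi> (c + d) e = \<phi> c e + \<phi> d e" "\<phi> c (d + e) = \<phi> c d + \<phi> c e" for c d e
    using assms by (auto simp: Hom2_iff)
  have "\<phi> (a + b) (a + b) = \<phi> a a + \<phi> a b + (\<phi> b a + \<phi> b b)"
    by (simp only: add) (simp add: alt)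
  then show ?thesis by (simp add: alt eq_neg_iff_add_eq_0)
qed

lemma br_Hom2: "br \<in> Hom2 scale"
  by (simp add: Hom2_iff br_add_left br_add_right br_scale_left br_scale_right br_self)

lemma br_antisym: "br a b = - br b a"
  by (rule alternating_antisym[OF br_Hom2])

lemma Hom2_diff_right:
  assumes "\<phi> \<in> Hom2 scale" shows "\<phi> a (b - c) = \<phi> a b - \<phi> a c"
proof -
  have "\<phi> a (b - c) + \<phi> a c = \<phi> a b" using assms unfolding Hom2_iff by (metis diff_add_cancel)
  then show ?thesis by (simp add: algebra_simps)
qed

lemma Hom2_diff_left:
  assumes "\<phi> \<in> Hom2 scale" shows "\<phi> (a - b) c = \<phi> a c - \<phi> b c"
  using Hom2_diff_right[OF assms, of c a b] alternating_antisym[OF assms, of c "a - b"]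
    alternating_antisym[OF assms, of c a] alternating_antisym[OF assms, of c b]
  by (simp add: algebra_simps)

lemmas br_diff_left = Hom2_diff_left[OF br_Hom2]
lemmas br_diff_right = Hom2_diff_right[OF br_Hom2]

lemma br_zero [simp]: "br 0 a = 0" "br a 0 = 0"
  using br_diff_left[of 0 0 a] br_diff_right[of a 0 0] by simp_all

lemma br_minus: "br (- a) b = - br a b" "br a (- b) = - br a b"
  using br_diff_left[of 0 a b] br_diff_right[of a 0 b] by simp_all

lemma leibniz: "br (br a b) c = br (br a c) b + br a (br b c)"
proof -
  have "br (br a c) b = br b (br c a)"
    using br_antisym[of "br a c" b] br_antisym[of a c] by (simp add: br_minus)
  moreover have "- br c (br a b) = br a (br b c) + br b (br c a)"
    using jacobi[of a b c] by (simp add: neg_eq_iff_add_eq_0 ac_simps)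
  ultimately show ?thesis
    using br_antisym[of "br a b" c] by (simp add: add.commute)
qed

lemma coboundary_Z2:
  assumes "f \<in> Hom1 scale"
  shows "coboundary br f \<in> Z2 scale br"
proof -
  have add: "f (a + b) = f a + f b" and scl: "f (scale r a) = scale r (f a)" for a b r
    using assms by (auto simp: Hom1_iff)
  have f0: "f 0 = 0" using add[of 0 0] by simp
  have fm: "f (- a) = - f a" for a using add[of a "- a"] by (simp add: f0 eq_neg_iff_add_eq_0 add.commute)
  have fd: "f (a - b) = f a - f b" for a b using add[of a "- b"] by (simp add: fm)
  have "coboundary br f \<in> Hom2 scale"
    unfolding Hom2_iff coboundary_def
    by (auto simp: add scl f0 br_add_left br_add_right br_scale_left br_scale_right br_self
        scale_right_diff_distrib scale_right_distrib br_antisym[of "f _"])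
  moreover have "br a (coboundary br f b c) - br (coboundary br f a b) c + br (coboundary br f a c) b
      + coboundary br f a (br b c) - coboundary br f (br a b) c + coboundary br f (br a c) b = 0" for a b c
  proof -
    have 1: "f (br (br a b) c) = f (br (br a c) b) + f (br a (br b c))"
      by (subst leibniz) (simp add: add)
    show ?thesis
      unfolding coboundary_def
      using leibniz[of "f a" b c] leibniz[of a "f b" c] leibniz[of a b "f c"]
      by (simp add: 1 br_diff_left br_diff_right br_add_left br_add_right algebra_simps)
  qed
  ultimately show ?thesis by (simp add: Z2_def)
qed

lemma Z2_Hom2: "\<phi> \<in> Z2 scale br \<Longrightarrow> \<phi> \<in> Hom2 scale"
  by (simp add: Z2_def)

lemma Z2_add:
  assumes "\<phi> \<in> Z2 scale br" "\<psi> \<in> Z2 scale br"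
  shows "(\<lambda>a b. \<phi> a b + \<psi> a b) \<in> Z2 scale br"
proof -
  have "(\<lambda>a b. \<phi> a b + \<psi> a b) \<in> Hom2 scale"
    using assms[THEN Z2_Hom2] by (auto simp: Hom2_iff scale_right_distrib)
  moreover have "br a (\<phi> b c + \<psi> b c) - br (\<phi> a b + \<psi> a b) c + br (\<phi> a c + \<psi> a c) b
      + (\<phi> a (br b c) + \<psi> a (br b c)) - (\<phi> (br a b) c + \<psi> (br a b) c)
      + (\<phi> (br a c) b + \<psi> (br a c) b) = 0" for a b c
  proof -
    have "br a (\<phi> b c + \<psi> b c) - br (\<phi> a b + \<psi> a b) c + br (\<phi> a c + \<psi> a c) b
      + (\<phi> a (br b c) + \<psi> a (br b c)) - (\<phi> (br a b) c + \<psi> (br a b) c)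
      + (\<phi> (br a c) b + \<psi> (br a c) b)
    = (br a (\<phi> b c) - br (\<phi> a b) c + br (\<phi> a c) b + \<phi> a (br b c) - \<phi> (br a b) c + \<phi> (br a c) b)
    + (br a (\<psi> b c) - br (\<psi> a b) c + br (\<psi> a c) b + \<psi> a (br b c) - \<psi> (br a b) c + \<psi> (br a c) b)"
      by (simp add: br_add_left br_add_right)
    also have "\<dots> = 0" using assms unfolding Z2_def by simp
    finally show ?thesis .
  qed
  ultimately show ?thesis by (simp add: Z2_def)
qed

lemma Z2_uminus:
  assumes "\<phi> \<in> Z2 scale br"
  shows "(\<lambda>a b. - \<phi> a b) \<in> Z2 scale br"
proof -
  have "(\<lambda>a b. - \<phi> a b) \<in> Hom2 scale"
    using assms[THEN Z2_Hom2] by (auto simp: Hom2_iff)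
  moreover have "br a (- \<phi> b c) - br (- \<phi> a b) c + br (- \<phi> a c) b
      + - \<phi> a (br b c) - - \<phi> (br a b) c + - \<phi> (br a c) b = 0" for a b c
  proof -
    have "br a (- \<phi> b c) - br (- \<phi> a b) c + br (- \<phi> a c) b
        + - \<phi> a (br b c) - - \<phi> (br a b) c + - \<phi> (br a c) b
      = - (br a (\<phi> b c) - br (\<phi> a b) c + br (\<phi> a c) b
        + \<phi> a (br b c) - \<phi> (br a b) c + \<phi> (br a c) b)"
      by (simp add: br_minus)
    also have "\<dots> = 0" using assms unfolding Z2_def by simp
    finally show ?thesis .
  qed
  ultimately show ?thesis by (simp add: Z2_def)
qed

lemma Z2_minus_coboundary:
  assumes "\<phi> \<in> Z2 scale br" "f \<in> Hom1 scale"
  shows "(\<lambda>a b. \<phi> a b - coboundary br f a b) \<in> Z2 scale br"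
  using Z2_add[OF assms(1) Z2_uminus[OF coboundary_Z2[OF assms(2)]]] by simp

lemma B2_iff: "\<psi> \<in> B2 scale br \<longleftrightarrow> (\<exists>f\<in>Hom1 scale. \<psi> = coboundary br f)"
proof -
  have "\<psi> = coboundary br f \<longleftrightarrow> (\<forall>a b. \<psi> a b = f (br a b) - br (f a) b - br a (f b))" for f
    by (simp add: coboundary_def fun_eq_iff)
  then show ?thesis
    using Z2_Hom2[OF coboundary_Z2] unfolding B2_def by blast
qed

text \<open>The form in which every normalization of a cocycle below is applied.\<close>

lemma B2_of_minus_coboundary:
  assumes "f \<in> Hom1 scale" "(\<lambda>a b. \<phi> a b - coboundary br f a b) \<in> B2 scale br"
  shows "\<phi> \<in> B2 scale br"
proof -
  obtain g where g: "g \<in> Hom1 scale" "(\<lambda>a b. \<phi> a b - coboundary br f a b) = coboundary br g"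
    using assms(2) by (auto simp: B2_iff)
  have "\<phi> a b = coboundary br (\<lambda>a. f a + g a) a b" for a b
    using fun_cong[OF fun_cong[OF g(2), of a], of b]
    by (simp add: coboundary_def br_add_left br_add_right algebra_simps)
  moreover have "(\<lambda>a. f a + g a) \<in> Hom1 scale"
    using assms(1) g(1) by (auto simp: Hom1_iff scale_right_distrib algebra_simps)
  ultimately show ?thesis unfolding B2_iff by blast
qed

lemma Z2_group_is_group: "group (Z2_group scale br)"
proof (rule groupI)
  show "\<exists>\<psi>\<in>carrier (Z2_group scale br). \<psi> \<otimes>\<^bsub>Z2_group scale br\<^esub> \<phi> = \<one>\<^bsub>Z2_group scale br\<^esub>"
    if "\<phi> \<in> carrier (Z2_group scale br)" for \<phi>
    using that Z2_uminus[of \<phi>] by (intro bexI[of _ "\<lambda>a b. - \<phi> a b"]) (auto simp: Z2_group_def)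
next
  have "(\<lambda>a b. 0) \<in> Z2 scale br"
    by (simp add: Z2_def Hom2_iff)
  then show "\<one>\<^bsub>Z2_group scale br\<^esub> \<in> carrier (Z2_group scale br)"
    by (simp add: Z2_group_def)
qed (simp_all add: Z2_group_def Z2_add add.assoc)

lemma H2_trivialI:
  assumes "Z2 scale br \<subseteq> B2 scale br"
  shows "trivial_group (H2 scale br)"
proof -
  interpret Z: group "Z2_group scale br" by (rule Z2_group_is_group)
  have B: "B2 scale br = carrier (Z2_group scale br)"
    using assms coboundary_Z2 by (auto simp: Z2_group_def B2_iff)
  have "carrier (Z2_group scale br) \<lhd> Z2_group scale br"
    by (rule Z.normal_invI[OF Z.subgroup_self]) simp
  then interpret N: normal "carrier (Z2_group scale br)" "Z2_group scale br" .
  have "group (H2 scale br)"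
    unfolding H2_def B by (rule N.factorgroup_is_group)
  moreover have "carrier (H2 scale br) = {\<one>\<^bsub>H2 scale br\<^esub>}"
    using Z.coset_join2[OF _ Z.subgroup_self] Z.one_closed
    unfolding H2_def B carrier_FactGroup by (auto simp: FactGroup_def)
  ultimately show ?thesis by (simp add: trivial_group_def)
qed

text \<open>
  An idempotent \<open>P = [\<cdot>, y]\<close> splits the algebra into its kernel and its image, and the derivation \<open>P\<close>
  makes this a grading by the weights 0 and 1. The cocycle identity for \<open>(a, b, y)\<close> says that the defect \<open>\<Delta>(a, b)\<close> of \<open>\<phi>(\<cdot>, y)\<close> from being a derivation equals
  \<open>P \<phi>(a, b) - \<phi>(a, P b) - \<phi>(P a, b)\<close>. If \<open>a\<close> and \<open>b\<close> have weights \<open>i\<close> and \<open>j\<close>, then the defect has weight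
  \<open>i + j\<close> by the hypothesis on \<open>\<phi>(\<cdot>, y)\<close>, whereas the right-hand side \<open>(P - i - j) \<phi>(a, b)\<close> has no
  component of that weight. So both sides vanish: \<open>\<phi>(\<cdot>, y)\<close> is a derivation and \<open>\<phi>(a, b)\<close> has weight \<open>i + j\<close>.
  Outside characteristic 2, the only vector of weight 2 is zero, because 2 is not an eigenvalue of an
  idempotent; for this reason two vectors of weight 1 commute, and \<open>\<phi>\<close> vanishes on them.
\<close>

lemma cocycle_weights:
  assumes idem: "\<And>a. br (br a y) y = br a y" and two: "(2::'k) \<noteq> 0"
    and \<phi>: "\<phi> \<in> Z2 scale br"
    and V: "\<And>a. br a y = a \<Longrightarrow> br (\<phi> a y) y = \<phi> a y"
    and g: "\<And>a. br a y = 0 \<Longrightarrow> br (\<phi> a y) y = 0"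
  shows "br a y = 0 \<Longrightarrow> br b y = 0 \<Longrightarrow> br (\<phi> a b) y = 0"
    and "br a y = a \<Longrightarrow> br b y = 0 \<Longrightarrow> br (\<phi> a b) y = \<phi> a b"
    and "br a y = a \<Longrightarrow> br b y = b \<Longrightarrow> \<phi> a b = 0"
    and "\<phi> (br c d) y = br (\<phi> c y) d + br c (\<phi> d y)"
proof -
  have H: "\<phi> \<in> Hom2 scale" using \<phi> by (rule Z2_Hom2)
  have add: "\<phi> (a + b) c = \<phi> a c + \<phi> b c" "\<phi> a (b + c) = \<phi> a b + \<phi> a c" for a b c
    using H by (auto simp: Hom2_iff)
  note diff = Hom2_diff_left[OF H] Hom2_diff_right[OF H]
  have zero: "\<phi> 0 a = 0" "\<phi> a 0 = 0" for a using diff(1)[of 0 0 a] diff(2)[of a 0 0] by simp_all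
  have double: "u = 0" if "u + u = 0" for u :: 'v
  proof -
    have "scale 2 u = 0" using that scale_left_distrib[of 1 1 u] by simp
    then show ?thesis using two by simp
  qed
  define \<Delta> where "\<Delta> a b = br (\<phi> a y) b + br a (\<phi> b y) - \<phi> (br a b) y" for a b
  have \<Delta>: "\<Delta> a b = br (\<phi> a b) y - \<phi> a (br b y) - \<phi> (br a y) b" for a b
  proof -
    have "br a (\<phi> b y) - br (\<phi> a b) y + br (\<phi> a y) b
        + \<phi> a (br b y) - \<phi> (br a b) y + \<phi> (br a y) b = 0"
      using \<phi> by (auto simp: Z2_def)
    then show ?thesis unfolding \<Delta>_def by (simp add: algebra_simps)
  qed
  have VV: "br a b = 0" if "br a y = a" "br b y = b" for a b
  proof -
    have 1: "br (br a b) y = br a b + br a b" using that by (subst leibniz) simp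
    have "br (br (br a b) y) y = br (br a b) y" by (rule idem)
    then have "br a b + br a b = 0" by (simp only: 1 br_add_left) simp
    then show ?thesis by (rule double)
  qed
  have gg: "br (\<phi> a b) y = 0 \<and> \<Delta> a b = 0" if "br a y = 0" "br b y = 0" for a b
  proof -
    have "br (\<Delta> a b) y = 0"
      unfolding \<Delta>_def br_diff_left br_add_left
      using that g[of a] g[of b] g[of "br a b"]
      by (simp add: leibniz[of _ _ y])
    moreover have "\<Delta> a b = br (\<phi> a b) y" using that by (simp add: \<Delta> zero)
    ultimately show ?thesis by (simp add: idem)
  qed
  have Vg: "br (\<phi> a b) y = \<phi> a b \<and> \<Delta> a b = 0" if "br a y = a" "br b y = 0" for a b
  proof -
    have ab: "br (br a b) y = br a b" using that by (subst leibniz) simp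
    have "br (\<Delta> a b) y = \<Delta> a b"
      unfolding \<Delta>_def br_diff_left br_add_left
      using that g[of b] V[of a] V[of "br a b"] ab
      by (simp add: leibniz[of "\<phi> a y" b y] leibniz[of a "\<phi> b y" y])
    moreover have D: "\<Delta> a b = br (\<phi> a b) y - \<phi> a b" using that by (simp add: \<Delta> zero)
    ultimately have "\<Delta> a b = 0" by (simp add: br_diff_left idem)
    then show ?thesis using D by simp
  qed
  have V2: "\<phi> a b = 0 \<and> \<Delta> a b = 0" if "br a y = a" "br b y = b" for a b
  proof -
    have D: "\<Delta> a b = 0"
      unfolding \<Delta>_def using that V[of a] V[of b] by (simp add: VV zero)
    have 1: "br (\<phi> a b) y = \<phi> a b + \<phi> a b" using D that \<Delta>[of a b] by (simp add: algebra_simps)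
    have "br (br (\<phi> a b) y) y = br (\<phi> a b) y" by (rule idem)
    then have "\<phi> a b + \<phi> a b = 0" by (simp only: 1 br_add_left) simp
    then show ?thesis using D double by blast
  qed
  show "br a y = 0 \<Longrightarrow> br b y = 0 \<Longrightarrow> br (\<phi> a b) y = 0" using gg by blast
  show "br a y = a \<Longrightarrow> br b y = 0 \<Longrightarrow> br (\<phi> a b) y = \<phi> a b" using Vg by blast
  show "br a y = a \<Longrightarrow> br b y = b \<Longrightarrow> \<phi> a b = 0" using V2 by blast
  have "\<Delta> c d = 0"
  proof -
    define c1 c0 d1 d0 where "c1 = br c y" "c0 = c - br c y" "d1 = br d y" "d0 = d - br d y"
    note defs = this
    have w: "br c1 y = c1" "br c0 y = 0" "br d1 y = d1" "br d0 y = 0"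
      by (simp_all add: defs idem br_diff_left)
    have anti: "\<Delta> a b = - \<Delta> b a" for a b
      unfolding \<Delta> using alternating_antisym[OF H, of a b] alternating_antisym[OF H, of a "br b y"]
         alternating_antisym[OF H, of "br a y" b] by (simp add: br_minus)
    have "\<Delta> c d = \<Delta> (c1 + c0) (d1 + d0)" by (simp add: defs)
    also have "\<dots> = \<Delta> c1 d1 + \<Delta> c1 d0 + \<Delta> c0 d1 + \<Delta> c0 d0"
      by (simp add: \<Delta>_def add br_add_left br_add_right)
    also have "\<dots> = 0" using w gg Vg V2 anti[of c0 d1] by simp
    finally show ?thesis .
  qed
  then show "\<phi> (br c d) y = br (\<phi> c y) d + br c (\<phi> d y)" by (simp add: \<Delta>_def)
qed

text \<open>
  The coboundary of a linear map \<open>f\<close> from weight \<open>i\<close> to weight \<open>j\<close> with \<open>f y = 0\<close> is \<open>(i - j) f\<close> at \<open>(\<cdot>, y)\<close>. So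
  each of the two weight-shifting components of \<open>\<phi>(\<cdot>, y)\<close>, where \<open>i - j = \<plusminus>1\<close>, is up to sign the map
  whose coboundary removes it.
\<close>

lemma exists_weight_preserving_representative:
  assumes idem: "\<And>a. br (br a y) y = br a y" and \<phi>: "\<phi> \<in> Hom2 scale"
  obtains f where "f \<in> Hom1 scale"
    and "\<And>a. br a y = a \<Longrightarrow>
      br (\<phi> a y - coboundary br f a y) y = \<phi> a y - coboundary br f a y"
    and "\<And>a. br a y = 0 \<Longrightarrow> br (\<phi> a y - coboundary br f a y) y = 0"
proof
  define D where "D a = \<phi> a y" for a
  have D: "D (a + b) = D a + D b" "D (scale r a) = scale r (D a)" "D y = 0" for a b r
    using \<phi> by (auto simp: Hom2_iff D_def)
  have Dd: "D (a - b) = D a - D b" for a b unfolding D_def by (rule Hom2_diff_left[OF \<phi>])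
  have D0: "D 0 = 0" using Dd[of 0 0] by simp
  define f where "f a = D (br a y) - br (D (br a y)) y - br (D (a - br a y)) y" for a
  show "f \<in> Hom1 scale"
    unfolding Hom1_iff f_def
    by (auto simp: D Dd br_add_left br_diff_left br_scale_left algebra_simps)
  have fy: "f y = 0" by (simp add: f_def br_self D0 D)
  show "br (\<phi> a y - coboundary br f a y) y = \<phi> a y - coboundary br f a y" if "br a y = a" for a
    unfolding coboundary_def fy using that
    by (simp add: f_def D_def[symmetric] D0 br_diff_left idem)
  show "br (\<phi> a y - coboundary br f a y) y = 0" if "br a y = 0" for a
    unfolding coboundary_def fy using that
    by (simp add: f_def D_def[symmetric] D0 br_diff_left br_minus idem)
qed

end

section \<open>Linear maps on the span of the basis\<close>

abbreviation bas :: "basis \<Rightarrow> R" where "bas a \<equiv> Poly_Mapping.single a 1"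

text \<open>\<open>E 0\<close> is \<open>e\<^sub>1\<close>, and the vectors \<open>E (Suc n)\<close> are the basis of the ideal \<open>V\<close>, with generator
  \<open>E (Suc 0)\<close>, that is \<open>e\<^sub>2\<close>.\<close>

abbreviation X :: R where "X \<equiv> bas BX"
abbreviation Y :: R where "Y \<equiv> bas BY"
abbreviation E :: "nat \<Rightarrow> R" where "E m \<equiv> bas (BE m)"

lemma R_Hom1_iff:
  "f \<in> Hom1 R_scale \<longleftrightarrow>
    (\<forall>u v. f (u + v) = f u + f v) \<and> (\<forall>c u. f (R_scale c u) = R_scale c (f u))"
  using vector_space_R by (auto simp: Hom1_def Vector_Spaces.linear_iff)

lemma R_Hom1_minus: "f \<in> Hom1 R_scale \<Longrightarrow> f (- u) = - f u"
  unfolding R_Hom1_iff by (metis R.scale_minus_left R.scale_one)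

lemma R_Hom1_zero: "f \<in> Hom1 R_scale \<Longrightarrow> f 0 = 0"
  unfolding R_Hom1_iff by (metis R.scale_zero_left)

lemma R_Hom1_sum:
  assumes "f \<in> Hom1 R_scale"
  shows "f (\<Sum>i\<in>I. R_scale (c i) (g i)) = (\<Sum>i\<in>I. R_scale (c i) (f (g i)))"
  using assms R_Hom1_zero[OF assms]
  by (induction I rule: infinite_finite_induct) (auto simp: R_Hom1_iff)

lemma R_linear_eqI:
  assumes "f \<in> Hom1 R_scale" "g \<in> Hom1 R_scale" "\<And>a. f (bas a) = g (bas a)"
  shows "f u = g u"
proof -
  have "f (\<Sum>a\<in>Poly_Mapping.keys u. R_scale (Poly_Mapping.lookup u a) (bas a))
      = g (\<Sum>a\<in>Poly_Mapping.keys u. R_scale (Poly_Mapping.lookup u a) (bas a))"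
    by (simp only: R_Hom1_sum[OF assms(1)] R_Hom1_sum[OF assms(2)] assms(3))
  then show ?thesis by (simp only: R_expand[symmetric])
qed

definition lin_ext :: "(basis \<Rightarrow> R) \<Rightarrow> R \<Rightarrow> R"
  where "lin_ext g u = (\<Sum>a\<in>Poly_Mapping.keys u. R_scale (Poly_Mapping.lookup u a) (g a))"

lemma lin_ext_bas [simp]: "lin_ext g (bas a) = g a"
  by (simp add: lin_ext_def)

lemma lin_ext_superset:
  assumes "finite A" "Poly_Mapping.keys u \<subseteq> A"
  shows "lin_ext g u = (\<Sum>a\<in>A. R_scale (Poly_Mapping.lookup u a) (g a))"
  unfolding lin_ext_def using assms by (intro sum.mono_neutral_left) (auto simp: in_keys_iff)

lemma lin_ext_Hom1: "lin_ext g \<in> Hom1 R_scale"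
proof -
  have "lin_ext g (u + v) = lin_ext g u + lin_ext g v" for u v
    using Poly_Mapping.keys_add[of u v]
    by (subst (1 2 3) lin_ext_superset[where A = "Poly_Mapping.keys u \<union> Poly_Mapping.keys v"])
      (auto simp: lookup_add R.scale_left_distrib sum.distrib)
  moreover have "lin_ext g (R_scale c u) = R_scale c (lin_ext g u)" for c u
  proof -
    have "Poly_Mapping.keys (R_scale c u) \<subseteq> Poly_Mapping.keys u" by (auto simp: in_keys_iff)
    then show ?thesis
      by (subst (1 2) lin_ext_superset[where A = "Poly_Mapping.keys u"]) (auto simp: R.scale_sum_right)
  qed
  ultimately show ?thesis by (simp add: R_Hom1_iff)
qed

definition diag :: "(basis \<Rightarrow> complex) \<Rightarrow> R \<Rightarrow> R"
  where "diag c = lin_ext (\<lambda>a. R_scale (c a) (bas a))"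

lemma diag_Hom1: "diag c \<in> Hom1 R_scale"
  unfolding diag_def by (rule lin_ext_Hom1)

lemma diag_bas: "diag c (bas a) = R_scale (c a) (bas a)"
  by (simp add: diag_def)

lemma lookup_diag [simp]: "Poly_Mapping.lookup (diag c u) a = c a * Poly_Mapping.lookup u a"
  unfolding diag_def lin_ext_def
  by (auto simp: lookup_sum lookup_single when_def in_keys_iff if_distrib[where f = "(*) _"] cong: if_cong)

section \<open>The structure of the algebra\<close>

text \<open>The eigenvalue of \<open>[\<cdot>, x]\<close> on \<open>e\<^sub>i\<close> for \<open>i \<ge> 2\<close> when \<open>\<beta> = 0\<close>; it is \<open>m\<close> because \<open>BE m\<close> stands for
  \<open>i = m + 1\<close>.\<close>

fun x_weight :: "basis \<Rightarrow> complex" where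
  "x_weight (BE m) = of_nat m"
| "x_weight _ = 0"

text \<open>The basis vectors of the abelian ideal \<open>V = \<langle>e\<^sub>2, e\<^sub>3, \<dots>\<rangle>\<close>.\<close>

fun in_V :: "basis \<Rightarrow> bool" where
  "in_V (BE (Suc n)) = True"
| "in_V _ = False"

context
  fixes t :: nat and \<beta> :: "nat \<Rightarrow> complex"
begin

interpretation L: lie_algebra R_scale "R_bracket t \<beta>"
  by (rule lie_algebra_R)

abbreviation br :: "R \<Rightarrow> R \<Rightarrow> R" where "br \<equiv> R_bracket t \<beta>"
abbreviation \<delta> :: "(R \<Rightarrow> R) \<Rightarrow> R \<Rightarrow> R \<Rightarrow> R" where "\<delta> \<equiv> coboundary br"
abbreviation shift :: "nat \<Rightarrow> R \<Rightarrow> R" where "shift j \<equiv> (\<lambda>u. br u (E 0)) ^^ j"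

lemma br_left_Hom1: "(\<lambda>u. br u v) \<in> Hom1 R_scale"
  by (simp add: R_Hom1_iff R_bracket_add_left R_bracket_scale_left)

lemma cochain_left_Hom1: "\<phi> \<in> Hom2 R_scale \<Longrightarrow> (\<lambda>u. \<phi> u v) \<in> Hom1 R_scale"
  by (simp add: R_Hom1_iff L.Hom2_iff)

lemma br_table:
  "br (E (Suc n)) (E 0) = E (Suc (Suc n))" "br (E 0) (E (Suc n)) = - E (Suc (Suc n))"
  "br (E 0) X = E 0" "br X (E 0) = - E 0" "br X Y = 0" "br Y X = 0" "br Y (E 0) = 0" "br Y (E (Suc n)) = - E (Suc n)"
  by (simp_all add: R_bracket_single R_e_def)

lemma br_Y: "br u Y = diag (\<lambda>a. if in_V a then 1 else 0) u"
proof (rule R_linear_eqI[OF br_left_Hom1 diag_Hom1])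
  show "br (bas a) Y = diag (\<lambda>a. if in_V a then 1 else 0) (bas a)" for a
    by (cases a rule: in_V.cases) (simp_all add: R_bracket_single diag_bas R_e_def)
qed

lemma br_Y_idem: "br (br u Y) Y = br u Y"
  by (rule poly_mapping_eqI) (simp add: br_Y)

lemma br_bas_Y: "br (bas a) Y = (if in_V a then bas a else 0)"
  by (simp add: br_Y diag_bas)

text \<open>The ideal \<open>V\<close> and the subalgebra \<open>g\<close> are expressed by \<open>br u Y = u\<close> and \<open>br u Y = 0\<close>.\<close>

lemma br_weight: "br u Y = u \<Longrightarrow> br v Y = 0 \<Longrightarrow> br (br u v) Y = br u v"
  by (subst L.leibniz) simp

lemma weight_0_expand:
  assumes "br u Y = 0"
  obtains a b c where "u = R_scale a X + R_scale b Y + R_scale c (E 0)"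
proof
  have 0: "Poly_Mapping.lookup u a = 0" if "in_V a" for a
    using that arg_cong[OF assms, of "\<lambda>v. Poly_Mapping.lookup v a"] by (simp add: br_Y)
  show "u = R_scale (Poly_Mapping.lookup u BX) X + R_scale (Poly_Mapping.lookup u BY) Y
      + R_scale (Poly_Mapping.lookup u (BE 0)) (E 0)"
  proof (rule poly_mapping_eqI)
    show "Poly_Mapping.lookup u a = Poly_Mapping.lookup (R_scale (Poly_Mapping.lookup u BX) X
      + R_scale (Poly_Mapping.lookup u BY) Y + R_scale (Poly_Mapping.lookup u (BE 0)) (E 0)) a" for a
      by (cases a rule: in_V.cases) (simp_all add: lookup_add lookup_single 0)
  qed
qed

lemma weight_1_lookup:
  assumes "br u Y = u" "\<not> in_V a"
  shows "Poly_Mapping.lookup u a = 0"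
  using assms(2) arg_cong[OF assms(1), of "\<lambda>v. Poly_Mapping.lookup v a"] by (simp add: br_Y)

lemma shift_Hom1: "shift j \<in> Hom1 R_scale"
  by (induction j) (auto simp: R_Hom1_iff R_bracket_add_left R_bracket_scale_left)

lemma shift_weight: "br u Y = u \<Longrightarrow> br (shift j u) Y = shift j u"
  by (induction j) (simp_all add: br_weight br_bas_Y)

lemma shift_E: "shift j (E (Suc n)) = E (Suc n + j)"
  by (induction j) (simp_all add: br_table)

lemma br_X:
  assumes "br u Y = u"
  shows "br u X = diag x_weight u + (\<Sum>q=3..t. R_scale (\<beta> q) (shift (q - 2) u))"
proof -
  have "br (br v Y) X = diag x_weight (br v Y) + (\<Sum>q=3..t. R_scale (\<beta> q) (shift (q - 2) (br v Y)))" for v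
  proof (rule R_linear_eqI[of "\<lambda>v. br (br v Y) X"
        "\<lambda>v. diag x_weight (br v Y) + (\<Sum>q=3..t. R_scale (\<beta> q) (shift (q - 2) (br v Y)))"])
    show "(\<lambda>v. br (br v Y) X) \<in> Hom1 R_scale"
      by (simp add: R_Hom1_iff R_bracket_add_left R_bracket_scale_left)
    show "(\<lambda>v. diag x_weight (br v Y) + (\<Sum>q=3..t. R_scale (\<beta> q) (shift (q - 2) (br v Y)))) \<in> Hom1 R_scale"
      using shift_Hom1 diag_Hom1[of x_weight]
      by (simp add: R_Hom1_iff R_bracket_add_left R_bracket_scale_left R.scale_right_distrib
          sum.distrib R.scale_sum_right mult.commute)
  next
    fix a
    show "br (br (bas a) Y) X
      = diag x_weight (br (bas a) Y) + (\<Sum>q=3..t. R_scale (\<beta> q) (shift (q - 2) (br (bas a) Y)))"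
    proof (cases a rule: in_V.cases)
      case (1 n)
      have "br (E (Suc n)) X = R_scale (of_nat (Suc n)) (E (Suc n))
          + (\<Sum>q=3..t. R_scale (\<beta> q) (R_e (q + (Suc n + 1) - 2)))"
        by (simp add: R_bracket_single R_e_def)
      moreover have "R_e (q + (Suc n + 1) - 2) = shift (q - 2) (E (Suc n))" if "q \<in> {3..t}" for q
        using that unfolding shift_E R_e_def by (intro arg_cong2[where f = Poly_Mapping.single] arg_cong[where f = BE]) auto
      ultimately show ?thesis using 1 by (simp add: br_bas_Y diag_bas)
    qed (simp_all add: br_bas_Y R_Hom1_zero[OF shift_Hom1] R_Hom1_zero[OF diag_Hom1])
  qed
  from this[of u] show ?thesis by (simp only: assms)
qed

text \<open>
  A map that commutes with \<open>S\<close> commutes with the polynomial in \<open>S\<close> that carries \<open>\<beta>\<close>, so only the diagonal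
  part of \<open>[\<cdot>, x]\<close> contributes to the commutator, and \<open>e\<^sub>2\<close> has eigenvalue 1 under it.
\<close>

lemma commutator_with_X:
  assumes T: "T \<in> Hom1 R_scale" and step: "\<And>n. T (E (Suc (Suc n))) = br (T (E (Suc n))) (E 0)"
    and V: "br (T (E (Suc 0))) Y = T (E (Suc 0))"
  shows "T (br (E (Suc 0)) X) - br (T (E (Suc 0))) X = T (E (Suc 0)) - diag x_weight (T (E (Suc 0)))"
proof -
  have shift: "T (shift j (E (Suc 0))) = shift j (T (E (Suc 0)))" for j
    unfolding shift_E by (induction j) (simp_all add: step)
  have "T (br (E (Suc 0)) X) = T (R_scale 1 (E (Suc 0)) + (\<Sum>q=3..t. R_scale (\<beta> q) (shift (q - 2) (E (Suc 0)))))"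
    by (subst br_X) (simp_all add: br_bas_Y diag_bas)
  also have "\<dots> = T (E (Suc 0)) + (\<Sum>q=3..t. R_scale (\<beta> q) (shift (q - 2) (T (E (Suc 0)))))"
    using T by (simp add: R_Hom1_iff R_Hom1_sum[OF T] shift)
  finally show ?thesis by (simp add: br_X[OF V])
qed

section \<open>Weight-preserving derivations\<close>

text \<open>
  The relation \<open>[e\<^sub>1, x] = e\<^sub>1\<close> forces \<open>D e\<^sub>1 = r e\<^sub>1\<close> and \<open>D x = b e\<^sub>1 + c y\<close>. Subtracting
  \<open>[\<cdot>, r x - b e\<^sub>1]\<close> gives a derivation \<open>D'\<close> that kills \<open>e\<^sub>1\<close>, hence commutes with \<open>S\<close>, and sends \<open>x\<close> to \<open>c y\<close>.
  Applied to \<open>[e\<^sub>2, x]\<close>, \<open>commutator_with_X\<close> shows that \<open>c = 0\<close> and that \<open>D' e\<^sub>2\<close> is a multiple \<open>s e\<^sub>2\<close>; so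
  \<open>D'\<close> is \<open>s\<close> times the projection \<open>[\<cdot>, y]\<close>.
\<close>

lemma derivation_inner:
  assumes D: "D \<in> Hom1 R_scale"
    and der: "\<And>a b. D (br a b) = br (D a) b + br a (D b)"
    and Y: "D Y = 0"
    and V: "\<And>a. br a Y = a \<Longrightarrow> br (D a) Y = D a"
    and g: "\<And>a. br a Y = 0 \<Longrightarrow> br (D a) Y = 0"
  obtains z where "br z Y = 0" "\<And>a. D a = br a z"
proof -
  note br_lin = R_bracket_add_left R_bracket_add_right R_bracket_scale_left R_bracket_scale_right
    L.br_diff_left L.br_diff_right L.br_minus L.br_self br_table
  obtain a b c where DX: "D X = R_scale a X + R_scale c Y + R_scale b (E 0)"
    using weight_0_expand[OF g[of X]] by (metis br_table(5))
  obtain p q r where DE: "D (E 0) = R_scale p X + R_scale q Y + R_scale r (E 0)"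
    using weight_0_expand[OF g[of "E 0"]] by (auto simp: br_bas_Y)
  \<comment> \<open>In \<open>D e\<^sub>1 = [D e\<^sub>1, x] + [e\<^sub>1, D x]\<close>, the right-hand side is a multiple of \<open>e\<^sub>1\<close>.\<close>
  have "D (br (E 0) X) = br (R_scale p X + R_scale q Y + R_scale r (E 0)) X
      + br (E 0) (R_scale a X + R_scale c Y + R_scale b (E 0))"
    by (simp only: der DX DE)
  also have "\<dots> = R_scale r (E 0) + R_scale a (E 0)"
    by (simp add: br_lin br_bas_Y)
  finally have "D (E 0) = R_scale (r + a) (E 0)"
    by (simp only: br_table R.scale_left_distrib)
  then have eq: "Poly_Mapping.lookup (R_scale p X + R_scale q Y + R_scale r (E 0)) k
      = Poly_Mapping.lookup (R_scale (r + a) (E 0)) k" for k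
    by (simp only: DE)
  have pqa: "p = 0" "q = 0" "a = 0"
    using eq[of BX] eq[of BY] eq[of "BE 0"] by (simp_all add: lookup_add lookup_single)
  define D' where "D' u = D u - br u (R_scale r X - R_scale b (E 0))" for u
  have D': "D' \<in> Hom1 R_scale"
    using D by (simp add: R_Hom1_iff D'_def R_bracket_add_left R_bracket_scale_left R.scale_right_diff_distrib)
  have der': "D' (br u v) = br (D' u) v + br u (D' v)" for u v
    unfolding D'_def der L.br_diff_left[of "D u"] L.br_diff_right[of u "D v"]
    by (subst L.leibniz[of u v]) simp
  have D'X: "D' X = R_scale c Y" and D'E: "D' (E 0) = 0" and D'Y: "D' Y = 0"
    by (simp_all add: D'_def DX DE Y br_lin pqa)
  define w where "w = D' (E (Suc 0))"
  have w: "br w Y = w"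
    unfolding w_def using der'[of "E (Suc 0)" Y] by (simp add: br_bas_Y D'Y)
  have step: "D' (E (Suc (Suc n))) = br (D' (E (Suc n))) (E 0)" for n
    using der'[of "E (Suc n)" "E 0"] by (simp add: br_table D'E)
  have "R_scale c (E (Suc 0)) = w - diag x_weight w"
    using commutator_with_X[OF D' step] w der'[of "E (Suc 0)" X]
    by (simp add: w_def[symmetric] D'X R_bracket_scale_right br_bas_Y)
  then have coeff: "Poly_Mapping.lookup (R_scale c (E (Suc 0))) k = Poly_Mapping.lookup (w - diag x_weight w) k" for k
    by (rule arg_cong)
  have c: "c = 0"
    using coeff[of "BE (Suc 0)"] by (simp add: lookup_minus lookup_single)
  define s where "s = Poly_Mapping.lookup w (BE (Suc 0))"
  have w_eq: "w = R_scale s (E (Suc 0))"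
  proof (rule poly_mapping_eqI)
    show "Poly_Mapping.lookup w k = Poly_Mapping.lookup (R_scale s (E (Suc 0))) k" for k
    proof (cases k rule: in_V.cases)
      case (1 n)
      show ?thesis
      proof (cases n)
        case 0
        then show ?thesis using 1 by (simp add: s_def lookup_single)
      next
        case (Suc m)
        then have "of_nat (Suc m) * Poly_Mapping.lookup w k = 0"
          using coeff[of k] 1 c by (simp add: lookup_minus lookup_single algebra_simps)
        then show ?thesis using 1 Suc by (simp add: lookup_single del: of_nat_Suc)
      qed
    qed (use weight_1_lookup[OF w, of k] in \<open>simp_all add: lookup_single\<close>)
  qed
  have "D' u = br u (R_scale s Y)" for u
  proof (rule R_linear_eqI[OF D' br_left_Hom1])
    fix k
    show "D' (bas k) = br (bas k) (R_scale s Y)"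
    proof (cases k rule: in_V.cases)
      case (1 n)
      have "D' (E (Suc n)) = R_scale s (E (Suc n))"
        by (induction n) (simp_all add: w_eq[unfolded w_def] step R_bracket_scale_left br_table)
      then show ?thesis using 1 by (simp add: R_bracket_scale_right br_bas_Y)
    qed (simp_all add: D'X D'Y D'E c R_bracket_scale_right br_bas_Y)
  qed
  then have "D u = br u (R_scale r X - R_scale b (E 0) + R_scale s Y)" for u
    using D'_def[of u] unfolding R_bracket_add_right by (simp add: algebra_simps)
  moreover have "br (R_scale r X - R_scale b (E 0) + R_scale s Y) Y = 0"
    by (simp add: br_lin br_bas_Y)
  ultimately show thesis by (rule that[rotated])
qed

section \<open>Normalizing cocycles\<close>

text \<open>The last normalization comes first: from \<open>B2_if_Y_e1_free\<close> on, each \<open>B2_if\<close> lemma subtracts a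
  coboundary to reach the hypotheses of the one before it.\<close>

abbreviation Z2R where "Z2R \<equiv> Z2 R_scale br"
abbreviation B2R where "B2R \<equiv> B2 R_scale br"

lemma zero_in_B2: "(\<lambda>a b. 0) \<in> B2R"
  unfolding L.B2_iff
  by (rule bexI[of _ "\<lambda>a. 0"]) (auto simp: coboundary_def fun_eq_iff R_Hom1_iff)

lemma weights_if_Y_free:
  assumes \<phi>: "\<phi> \<in> Z2R" and Y: "\<And>a. \<phi> a Y = 0"
  shows "br a Y = 0 \<Longrightarrow> br b Y = 0 \<Longrightarrow> br (\<phi> a b) Y = 0"
    and "br a Y = a \<Longrightarrow> br b Y = 0 \<Longrightarrow> br (\<phi> a b) Y = \<phi> a b"
    and "br a Y = a \<Longrightarrow> br b Y = b \<Longrightarrow> \<phi> a b = 0"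
  using L.cocycle_weights[OF br_Y_idem _ \<phi>] by (simp_all add: Y)

text \<open>Weight-preserving maps that kill \<open>y\<close> leave \<open>\<phi>(\<cdot>, y)\<close> unchanged, so later normalizations do not undo
  that of \<open>\<phi>(\<cdot>, y)\<close>.\<close>

lemma coboundary_Y_zero:
  assumes f: "f \<in> Hom1 R_scale" and "f Y = 0" and g: "br (f X) Y = 0" "br (f (E 0)) Y = 0"
    and V: "\<And>n. br (f (E (Suc n))) Y = f (E (Suc n))"
  shows "\<delta> f a Y = 0"
proof (rule R_linear_eqI[of "\<lambda>a. \<delta> f a Y" "\<lambda>a. 0"])
  show "\<delta> f (bas k) Y = 0" for k
    by (cases k rule: in_V.cases)
      (simp_all add: coboundary_def assms br_bas_Y R_Hom1_zero[OF f])
  show "(\<lambda>a. \<delta> f a Y) \<in> Hom1 R_scale"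
    by (rule cochain_left_Hom1[OF L.Z2_Hom2[OF L.coboundary_Z2[OF f]]])
qed (simp add: R_Hom1_iff)

text \<open>
  The cocycle identity for \<open>(e\<^sub>i, x, e\<^sub>1)\<close> shows that \<open>\<phi>(\<cdot>, x)\<close> commutes with \<open>S\<close> on \<open>V\<close>, so it vanishes on \<open>V\<close>
  with its value at the generator \<open>e\<^sub>2\<close>. Then \<open>\<phi>\<close> is zero on all pairs of basis vectors.
\<close>

lemma B2_if_normal_form:
  assumes \<phi>: "\<phi> \<in> Z2R" and Y: "\<And>a. \<phi> a Y = 0" and XE: "\<phi> X (E 0) = 0"
    and VE: "\<And>n. \<phi> (E (Suc n)) (E 0) = 0" and EX: "\<phi> (E (Suc 0)) X = 0"
  shows "\<phi> \<in> B2R"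
proof -
  have H: "\<phi> \<in> Hom2 R_scale" using \<phi> by (rule L.Z2_Hom2)
  note anti = L.alternating_antisym[OF H]
  have step: "\<phi> (E (Suc (Suc n))) X = br (\<phi> (E (Suc n)) X) (E 0)" for n
  proof -
    have "br (E (Suc n)) (\<phi> X (E 0)) - br (\<phi> (E (Suc n)) X) (E 0) + br (\<phi> (E (Suc n)) (E 0)) X
      + \<phi> (E (Suc n)) (br X (E 0)) - \<phi> (br (E (Suc n)) X) (E 0) + \<phi> (br (E (Suc n)) (E 0)) X = 0"
      using \<phi> unfolding Z2_def by blast
    moreover have "\<phi> (E (Suc n)) (br X (E 0)) = 0"
      using L.Hom2_diff_right[OF H, of _ 0 "E 0"] L.Hom2_diff_right[OF H, of _ 0 0] by (simp add: br_table VE)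
    moreover have "\<phi> (br (E (Suc n)) X) (E 0) = 0"
    proof -
      have "\<phi> (br u Y) (E 0) = 0" for u
      proof (rule R_linear_eqI[of "\<lambda>u. \<phi> (br u Y) (E 0)" "\<lambda>u. 0"])
        show "\<phi> (br (bas k) Y) (E 0) = 0" for k
          using L.Hom2_diff_left[OF H, of 0 0]
          by (cases k rule: in_V.cases) (simp_all add: br_bas_Y VE)
      qed (use H in \<open>simp_all add: R_Hom1_iff L.Hom2_iff R_bracket_add_left R_bracket_scale_left\<close>)
      from this[of "br (E (Suc n)) X"] show ?thesis
        by (simp add: br_weight br_bas_Y)
    qed
    ultimately show ?thesis by (simp add: XE VE br_table)
  qed
  have VX: "\<phi> (E (Suc n)) X = 0" for n
    by (induction n) (simp_all add: EX step)
  have VV: "\<phi> (E (Suc n)) (E (Suc m)) = 0" for n m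
    by (rule weights_if_Y_free(3)[OF \<phi> Y]) (simp_all add: br_bas_Y)
  have alt: "\<phi> a a = 0" for a using H by (simp add: L.Hom2_iff)
  have rev: "\<phi> Y a = 0" "\<phi> (E 0) X = 0" "\<phi> X (E (Suc n)) = 0" "\<phi> (E 0) (E (Suc n)) = 0" for a n
    using anti[of Y a] anti[of "E 0" X] anti[of X "E (Suc n)"] anti[of "E 0" "E (Suc n)"]
    by (simp_all only: Y XE VX VE minus_zero)
  have basis: "\<phi> (bas a) (bas b) = 0" for a b
    by (cases a rule: in_V.cases; cases b rule: in_V.cases)
      (simp_all add: VV VX VE XE alt Y rev)
  have bas_left: "\<phi> (bas a) v = 0" for a v
    by (rule R_linear_eqI[of "\<phi> (bas a)" "\<lambda>_. 0"]) (use H basis in \<open>simp_all add: R_Hom1_iff L.Hom2_iff\<close>)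
  have "\<phi> u v = 0" for u v
    by (rule R_linear_eqI[of "\<lambda>u. \<phi> u v" "\<lambda>_. 0"]) (use H bas_left in \<open>simp_all add: R_Hom1_iff L.Hom2_iff\<close>)
  then have "\<phi> = (\<lambda>a b. 0)" by (intro ext)
  then show ?thesis using zero_in_B2 by simp
qed

text \<open>
  For \<open>f\<close> commuting with \<open>S\<close> on \<open>V\<close> with \<open>f e\<^sub>2 = r\<close>, \<open>f x = -s y\<close> and \<open>f y = f e\<^sub>1 = 0\<close>, the coboundary at
  \<open>(e\<^sub>2, x)\<close> is \<open>r\<close> minus its image under the diagonal part of \<open>[\<cdot>, x]\<close>, plus \<open>s e\<^sub>2\<close>. This can be solved for
  any prescribed value in \<open>V\<close>: divide the coefficients off \<open>e\<^sub>2\<close> by \<open>1 - (i - 1)\<close> and let \<open>s\<close> be the coefficient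
  at \<open>e\<^sub>2\<close>.
\<close>

lemma B2_if_Y_e1_free:
  assumes \<phi>: "\<phi> \<in> Z2R" and Y: "\<And>a. \<phi> a Y = 0" and XE: "\<phi> X (E 0) = 0"
    and VE: "\<And>n. \<phi> (E (Suc n)) (E 0) = 0"
  shows "\<phi> \<in> B2R"
proof -
  define q where "q = \<phi> (E (Suc 0)) X"
  have q: "br q Y = q"
    unfolding q_def by (rule weights_if_Y_free(2)[OF \<phi> Y]) (simp_all add: br_bas_Y)
  define s where "s = Poly_Mapping.lookup q (BE (Suc 0))"
  \<comment> \<open>At \<open>e\<^sub>2\<close>, where \<open>x_weight\<close> is 1, division by zero gives the coefficient 0.\<close>
  define r where "r = diag (\<lambda>a. 1 / (1 - x_weight a)) q"
  have r: "br r Y = r"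
  proof (rule poly_mapping_eqI)
    show "Poly_Mapping.lookup (br r Y) k = Poly_Mapping.lookup r k" for k
      using weight_1_lookup[OF q, of k] by (simp add: br_Y r_def)
  qed
  define f where "f = lin_ext (\<lambda>a. case a of BX \<Rightarrow> R_scale (- s) Y | BY \<Rightarrow> 0
    | BE m \<Rightarrow> (case m of 0 \<Rightarrow> 0 | Suc n \<Rightarrow> shift n r))"
  have f: "f \<in> Hom1 R_scale" unfolding f_def by (rule lin_ext_Hom1)
  have fv: "f X = R_scale (- s) Y" "f Y = 0" "f (E 0) = 0" "f (E (Suc n)) = shift n r" for n
    by (simp_all add: f_def)
  let ?\<psi> = "\<lambda>a b. \<phi> a b - \<delta> f a b"
  have "?\<psi> \<in> B2R"
  proof (rule B2_if_normal_form)
    show "?\<psi> \<in> Z2R" by (rule L.Z2_minus_coboundary[OF \<phi> f])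
    show "?\<psi> a Y = 0" for a
      using coboundary_Y_zero[OF f, of a]
      by (simp add: fv Y R_bracket_scale_left L.br_minus br_table br_bas_Y shift_weight[OF r] R_bracket_self)
    show "?\<psi> X (E 0) = 0"
      by (simp add: XE coboundary_def fv L.br_minus R_bracket_scale_left br_table R_Hom1_minus[OF f])
    show "?\<psi> (E (Suc n)) (E 0) = 0" for n
      by (simp add: VE coboundary_def fv br_table)
    have "\<delta> f (E (Suc 0)) X = r - diag x_weight r + R_scale s (E (Suc 0))"
      using commutator_with_X[OF f]
      by (simp add: coboundary_def fv L.br_minus br_table r R_bracket_scale_right br_bas_Y)
    also have "\<dots> = q"
    proof (rule poly_mapping_eqI)
      fix k
      show "Poly_Mapping.lookup (r - diag x_weight r + R_scale s (E (Suc 0))) k = Poly_Mapping.lookup q k"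
      proof (cases k rule: in_V.cases)
        case (1 n)
        show ?thesis
        proof (cases n)
          case 0
          then show ?thesis using 1 by (simp add: r_def s_def lookup_add lookup_minus lookup_single)
        next
          case (Suc m)
          then have "1 - x_weight k = - of_nat (Suc m)" using 1 by simp
          then have "1 - x_weight k \<noteq> 0" by (simp del: of_nat_Suc)
          then have "(1 - x_weight k) * Poly_Mapping.lookup r k = Poly_Mapping.lookup q k"
            by (simp add: r_def)
          then show ?thesis using 1 Suc
            by (simp add: lookup_add lookup_minus lookup_single left_diff_distrib del: x_weight.simps)
        qed
      qed (use weight_1_lookup[OF q, of k] in \<open>simp_all add: lookup_single lookup_add lookup_minus r_def\<close>)
    qed
    finally show "?\<psi> (E (Suc 0)) X = 0" by (simp add: q_def)
  qed
  then show ?thesis by (rule L.B2_of_minus_coboundary[OF f])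
qed

text \<open>
  The choices \<open>f x = r x\<close> and \<open>f e\<^sub>1 = h = -(p x + s y)\<close> give the coboundary of \<open>f\<close> at \<open>(x, e\<^sub>1)\<close> the value
  \<open>-h + r e\<^sub>1\<close>, which is \<open>\<phi>(x, e\<^sub>1)\<close>. On \<open>V\<close>, the condition that the coboundary of \<open>f\<close> agrees with \<open>\<phi>\<close> at
  \<open>(e\<^sub>i, e\<^sub>1)\<close> expresses \<open>f e\<^bsub>i+1\<^esub>\<close> through \<open>f e\<^sub>i\<close>, so \<open>f\<close> is defined by recursion from \<open>f e\<^sub>2 = 0\<close>.
\<close>

lemma B2_if_Y_free:
  assumes \<phi>: "\<phi> \<in> Z2R" and Y: "\<And>a. \<phi> a Y = 0"
  shows "\<phi> \<in> B2R"
proof -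
  obtain p s r where w: "\<phi> X (E 0) = R_scale p X + R_scale s Y + R_scale r (E 0)"
    by (rule weight_0_expand[OF weights_if_Y_free(1)[OF \<phi> Y], of X "E 0"]) (auto simp: br_bas_Y)
  define h where "h = - (R_scale p X + R_scale s Y)"
  have h: "br h Y = 0"
    by (simp add: h_def L.br_minus L.br_diff_left R_bracket_scale_left br_table R_bracket_self)
  define F where "F = rec_nat 0 (\<lambda>n u. \<phi> (E (Suc n)) (E 0) + br u (E 0) + br (E (Suc n)) h)"
  have F_Suc: "F (Suc n) = \<phi> (E (Suc n)) (E 0) + br (F n) (E 0) + br (E (Suc n)) h" for n
    by (simp add: F_def)
  have F: "br (F n) Y = F n" for n
  proof (induction n)
    case 0
    then show ?case by (simp add: F_def)
  next
    case (Suc n)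
    then show ?case
      unfolding F_Suc R_bracket_add_left[of _ _ _ _ Y]
      by (simp add: br_weight h br_bas_Y weights_if_Y_free(2)[OF \<phi> Y])
  qed
  define f where "f = lin_ext (\<lambda>a. case a of BX \<Rightarrow> R_scale r X | BY \<Rightarrow> 0
    | BE m \<Rightarrow> (case m of 0 \<Rightarrow> h | Suc n \<Rightarrow> F n))"
  have f: "f \<in> Hom1 R_scale" unfolding f_def by (rule lin_ext_Hom1)
  have fv: "f X = R_scale r X" "f Y = 0" "f (E 0) = h" "f (E (Suc n)) = F n" for n
    by (simp_all add: f_def)
  let ?\<psi> = "\<lambda>a b. \<phi> a b - \<delta> f a b"
  have "?\<psi> \<in> B2R"
  proof (rule B2_if_Y_e1_free)
    show "?\<psi> \<in> Z2R" by (rule L.Z2_minus_coboundary[OF \<phi> f])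
    show "?\<psi> a Y = 0" for a
      using coboundary_Y_zero[OF f, of a] by (simp add: fv Y R_bracket_scale_left br_table h F)
    have "br X h = 0"
      by (simp add: h_def L.br_minus L.br_diff_right R_bracket_scale_right br_table R_bracket_self)
    then show "?\<psi> X (E 0) = 0"
      by (simp add: w coboundary_def fv R_bracket_scale_left br_table R_Hom1_minus[OF f] h_def)
    show "?\<psi> (E (Suc n)) (E 0) = 0" for n
      by (simp add: coboundary_def fv br_table F_Suc)
  qed
  then show ?thesis by (rule L.B2_of_minus_coboundary[OF f])
qed

text \<open>
  If \<open>\<phi>(\<cdot>, y) = [\<cdot>, z]\<close> with \<open>z\<close> of weight 0, then the coboundary of the map \<open>y \<mapsto> -z\<close>, zero on the other basis
  vectors, takes the same values at \<open>(\<cdot>, y)\<close>.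
\<close>

lemma B2_if_weight_preserving:
  assumes \<phi>: "\<phi> \<in> Z2R"
    and V: "\<And>a. br a Y = a \<Longrightarrow> br (\<phi> a Y) Y = \<phi> a Y"
    and g: "\<And>a. br a Y = 0 \<Longrightarrow> br (\<phi> a Y) Y = 0"
  shows "\<phi> \<in> B2R"
proof -
  have H: "\<phi> \<in> Hom2 R_scale" using \<phi> by (rule L.Z2_Hom2)
  obtain z where z: "br z Y = 0" "\<And>a. \<phi> a Y = br a z"
  proof (rule derivation_inner[of "\<lambda>a. \<phi> a Y"])
    show "\<phi> (br a b) Y = br (\<phi> a Y) b + br a (\<phi> b Y)" for a b
      by (rule L.cocycle_weights(4)[OF br_Y_idem _ \<phi> V g]) simp_all
    show "\<phi> Y Y = 0" using H by (simp add: L.Hom2_iff)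
  qed (use V g cochain_left_Hom1[OF H] in blast)+
  define f where "f = lin_ext (\<lambda>a. if a = BY then - z else 0)"
  have f: "f \<in> Hom1 R_scale" unfolding f_def by (rule lin_ext_Hom1)
  have fY: "f Y = - z" by (simp add: f_def)
  have fV: "f (br a Y) = 0" for a
  proof (rule R_linear_eqI[of "\<lambda>a. f (br a Y)" "\<lambda>_. 0"])
    show "f (br (bas k) Y) = 0" for k
      by (cases k rule: in_V.cases) (simp_all add: br_bas_Y R_Hom1_zero[OF f], simp add: f_def)
  qed (use f in \<open>simp_all add: R_Hom1_iff R_bracket_add_left R_bracket_scale_left\<close>)
  have fg: "br (f a) Y = 0" for a
  proof (rule R_linear_eqI[of "\<lambda>a. br (f a) Y" "\<lambda>_. 0"])
    show "br (f (bas k)) Y = 0" for k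
      by (simp add: f_def L.br_minus z(1))
  qed (use f in \<open>simp_all add: R_Hom1_iff R_bracket_add_left R_bracket_scale_left\<close>)
  have "(\<lambda>a b. \<phi> a b - \<delta> f a b) \<in> B2R"
  proof (rule B2_if_Y_free[OF L.Z2_minus_coboundary[OF \<phi> f]])
    show "\<phi> a Y - \<delta> f a Y = 0" for a
      by (simp add: coboundary_def fV fg fY z(2) L.br_minus)
  qed
  then show ?thesis by (rule L.B2_of_minus_coboundary[OF f])
qed

lemma Z2_subset_B2: "Z2R \<subseteq> B2R"
proof
  fix \<phi> assume \<phi>: "\<phi> \<in> Z2R"
  obtain f where f: "f \<in> Hom1 R_scale"
    and "\<And>a. br a Y = a \<Longrightarrow> br (\<phi> a Y - \<delta> f a Y) Y = \<phi> a Y - \<delta> f a Y"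
    and "\<And>a. br a Y = 0 \<Longrightarrow> br (\<phi> a Y - \<delta> f a Y) Y = 0"
    using L.exists_weight_preserving_representative[OF br_Y_idem L.Z2_Hom2[OF \<phi>]] by metis
  then have "(\<lambda>a b. \<phi> a b - \<delta> f a b) \<in> B2R"
    by (intro B2_if_weight_preserving L.Z2_minus_coboundary[OF \<phi> f])
  then show "\<phi> \<in> B2R" by (rule L.B2_of_minus_coboundary[OF f])
qed

end

theorem theorem3p4:
  fixes t :: nat and \<beta> :: "nat \<Rightarrow> complex"
  shows "trivial_group (H2 R_scale (R_bracket t \<beta>))"
  by (rule lie_algebra.H2_trivialI[OF lie_algebra_R Z2_subset_B2])

end
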